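(* Let $n,d\ge1$ be integers. If $\mathcal{T}\in\mathbb{C}^{n^{2d}}$ is a CPS tensor, then $$\operatorname{rank}(\mathcal{T})\le\operatorname{rank}_{\mathrm{PS}}(\mathcal{T})=\operatorname{rank}_{\mathrm{CPS}}(\mathcal{T}).$$ Moreover, there exists a CPS tensor $\mathcal{T}$ (for some $n$ and $d$) such that $\operatorname{rank}(\mathcal{T})<\operatorname{rank}_{\mathrm{PS}}(\mathcal{T})$.
   Context: $\mathbb{C}^{n^{2d}}$ denotes the space of complex tensors of order $2d$ with every mode of dimension $n$. $\mathcal{T}\in\mathbb{C}^{n^{2d}}$ is partial-symmetric (PS) if its entries are invariant under any permutation of the first $d$ indices and under any permutation of the last $d$ indices. It is conjugate partial-symmetric (CPS) if it is PS and $\mathcal{T}_{i_1\dots i_d i_{d+1}\dots i_{2d}}=\overline{\mathcal{T}_{i_{d+1}\dots i_{2d}i_1\dots i_d}}$ for all indices. Ranks: $\operatorname{rank}(\mathcal{T})$ is the smallest $r$ such that $\mathcal{T}=\sum_{j=1}^r\boldsymbol{a}_{j1}\otimes\dots\otimes\boldsymbol{a}_{j,2d}$ with $\boldsymbol{a}_{jk}\in\mathbb{C}^n$. For a PS tensor, $\operatorname{rank}_{\mathrm{PS}}(\mathcal{T})$ is the smallest $r$ such that $\mathcal{T}=\sum_{j=1}^r\lambda_j\overline{\boldsymbol{a}_j}^{\otimes d}\otimes\boldsymbol{a}_j^{\otimes d}$ with $\lambda_j\in\mathbb{C}$, $\boldsymbol{a}_j\in\mathbb{C}^n$. For a CPS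 tensor, $\operatorname{rank}_{\mathrm{CPS}}(\mathcal{T})$ is defined in the same way but with $\lambda_j\in\mathbb{R}$. (Such decompositions always exist for PS and CPS tensors respectively, so these ranks are finite.) Here $\boldsymbol{x}^{\otimes d}$ is the outer product of $d$ copies of $\boldsymbol{x}$ and the bar is entrywise conjugation. *)

theory Defs
  imports Complex_Main
    "Jordan_Normal_Form.Matrix"
    "HOL-Combinatorics.Permutations"
    "HOL-Library.Extended_Nat"
begin

definition indices :: "nat \<Rightarrow> nat \<Rightarrow> nat list set" where
  "indices n m = {I. length I = m \<and> set I \<subseteq> {..<n}}"

text \<open>A complex tensor of order \<open>m\<close> whose modes all have dimension \<open>n\<close> is a function on the
  multi-indices (counted from 0), extended by 0 to all lists, so that equality of tensors is
  equality of functions and the tensors of a given format are closed under pointwise sums.\<close>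

definition tensors :: "nat \<Rightarrow> nat \<Rightarrow> (nat list \<Rightarrow> complex) set" where
  "tensors n m = {T. \<forall>I. I \<notin> indices n m \<longrightarrow> T I = 0}"

definition partial_symmetric :: "nat \<Rightarrow> nat \<Rightarrow> (nat list \<Rightarrow> complex) \<Rightarrow> bool" where
  "partial_symmetric n d T \<longleftrightarrow> T \<in> tensors n (2 * d) \<and>
     (\<forall>I\<in>indices n d. \<forall>J\<in>indices n d. \<forall>p q. p permutes {..<d} \<longrightarrow> q permutes {..<d} \<longrightarrow>
        T (permute_list p I @ permute_list q J) = T (I @ J))"

definition conj_partial_symmetric :: "nat \<Rightarrow> nat \<Rightarrow> (nat list \<Rightarrow> complex) \<Rightarrow> bool" where
  "conj_partial_symmetric n d T \<longleftrightarrow> partial_symmetric n d T \<and>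
     (\<forall>I\<in>indices n d. \<forall>J\<in>indices n d. T (I @ J) = cnj (T (J @ I)))"

definition outer_product :: "nat \<Rightarrow> complex vec list \<Rightarrow> nat list \<Rightarrow> complex" where
  "outer_product n vs I =
     (if I \<in> indices n (length vs) then \<Prod>k<length vs. (vs ! k) $ (I ! k) else 0)"

text \<open>The ranks below are infima in \<^typ>\<open>enat\<close>: the least length of a decomposition if there is
  one, and \<open>\<infinity>\<close> otherwise.\<close>

definition tensor_rank :: "nat \<Rightarrow> nat \<Rightarrow> (nat list \<Rightarrow> complex) \<Rightarrow> enat" where
  "tensor_rank n m T = Inf {enat r | r.
     \<exists>a :: nat \<Rightarrow> nat \<Rightarrow> complex vec.
       (\<forall>j<r. \<forall>k<m. a j k \<in> carrier_vec n) \<and>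
       T = (\<lambda>I. \<Sum>j<r. outer_product n (map (a j) [0..<m]) I)}"

definition ps_rank :: "nat \<Rightarrow> nat \<Rightarrow> (nat list \<Rightarrow> complex) \<Rightarrow> enat" where
  "ps_rank n d T = Inf {enat r | r.
     \<exists>(c :: nat \<Rightarrow> complex) (a :: nat \<Rightarrow> complex vec).
       (\<forall>j<r. a j \<in> carrier_vec n) \<and>
       T = (\<lambda>I. \<Sum>j<r. c j *
              outer_product n (replicate d (conjugate (a j)) @ replicate d (a j)) I)}"

definition cps_rank :: "nat \<Rightarrow> nat \<Rightarrow> (nat list \<Rightarrow> complex) \<Rightarrow> enat" where
  "cps_rank n d T = Inf {enat r | r.
     \<exists>(c :: nat \<Rightarrow> real) (a :: nat \<Rightarrow> complex vec).
       (\<forall>j<r. a j \<in> carrier_vec n) \<and>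
       T = (\<lambda>I. \<Sum>j<r. complex_of_real (c j) *
              outer_product n (replicate d (conjugate (a j)) @ replicate d (a j)) I)}"

end

theory Submission
  imports Defs
begin

text \<open>Swapping the two halves of the multi-index and conjugating fixes a CPS tensor and every
  tensor \<open>\<lambda>I. outer_product n (replicate d (conjugate a) @ replicate d a) I\<close>; averaging a PS
  decomposition with its image therefore replaces each coefficient by its real part. For the
  strict inequality take \<open>n = d = 2\<close> and \<open>T = e\<^sub>0 \<otimes> e\<^sub>0 \<otimes> e\<^sub>1 \<otimes> e\<^sub>1 + e\<^sub>1 \<otimes> e\<^sub>1 \<otimes> e\<^sub>0 \<otimes> e\<^sub>0\<close>. In a PS
  decomposition with two terms \<open>a\<^sub>j = (x\<^sub>j, y\<^sub>j)\<close>, the entries 0000, 0001, 0011 of \<open>T\<close> say that the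
  ratios \<open>y\<^sub>j / x\<^sub>j\<close> solve a Vandermonde system with moments 0, 0, 1, which is impossible.\<close>

section \<open>Outer products of concatenated, conjugated and scaled factors\<close>

lemma append_in_indices:
  "length I = d \<Longrightarrow> I @ J \<in> indices n (d + e) \<longleftrightarrow> I \<in> indices n d \<and> J \<in> indices n e"
  by (auto simp: indices_def)

lemma indices_split:
  assumes "K \<in> indices n (d + e)"
  obtains I J where "K = I @ J" "I \<in> indices n d" "J \<in> indices n e"
proof
  show "K = take d K @ drop d K" by simp
  show "take d K \<in> indices n d" "drop d K \<in> indices n e"
    using assms by (auto simp: indices_def dest: in_set_takeD in_set_dropD)
qed

lemma prod_lessThan_add:
  fixes f :: "nat \<Rightarrow> 'a::comm_monoid_mult"
  shows "prod f {..<m + n} = prod f {..<m} * (\<Prod>k<n. f (m + k))"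
  by (induction n) (simp_all add: mult.assoc)

lemma outer_product_append:
  assumes "I \<in> indices n (length us)" "J \<in> indices n (length vs)"
  shows "outer_product n (us @ vs) (I @ J) = outer_product n us I * outer_product n vs J"
proof -
  have "length I = length us" using assms by (simp add: indices_def)
  with assms show ?thesis
    by (simp add: outer_product_def append_in_indices prod_lessThan_add nth_append)
qed

lemma cnj_outer_product_replicate:
  assumes "a \<in> carrier_vec n"
  shows "cnj (outer_product n (replicate d a) I) = outer_product n (replicate d (conjugate a)) I"
proof (cases "I \<in> indices n d")
  case True
  then have "I ! k < n" if "k < d" for k
    using that nth_mem[of k I] by (auto simp: indices_def simp del: nth_mem)
  with assms True show ?thesis by (auto simp: outer_product_def intro!: prod.cong)
qed (simp add: outer_product_def)

text \<open>The product splits over the two blocks. Conjugation turns the factor at \<open>J\<close>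
  into one of \<open>a\<close> and the factor at \<open>I\<close> into one of
  \<open>conjugate a\<close>, so the blocks trade places.\<close>

lemma cnj_outer_product_conjugate:
  assumes "a \<in> carrier_vec n" "I \<in> indices n d" "J \<in> indices n d"
  shows "cnj (outer_product n (replicate d (conjugate a) @ replicate d a) (J @ I)) =
         outer_product n (replicate d (conjugate a) @ replicate d a) (I @ J)"
  using assms cnj_outer_product_replicate[of a n d]
    cnj_outer_product_replicate[of "conjugate a" n d]
  by (simp add: outer_product_append)

lemma outer_product_smult_Cons:
  assumes "v \<in> carrier_vec n"
  shows "outer_product n (c \<cdot>\<^sub>v v # vs) I = c * outer_product n (v # vs) I"
proof (cases "I \<in> indices n (Suc (length vs))")
  case True
  then have "I ! 0 < n" by (cases I) (auto simp: indices_def)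
  with assms True show ?thesis by (simp add: outer_product_def prod.lessThan_Suc_shift del: prod.lessThan_Suc)
qed (simp add: outer_product_def)

section \<open>Comparison of the three ranks\<close>

lemma tensor_rank_le_ps_rank:
  assumes "d \<ge> 1"
  shows "tensor_rank n (2 * d) T \<le> ps_rank n d T"
  unfolding ps_rank_def
proof (rule Inf_greatest, clarsimp)
  fix r c and a :: "nat \<Rightarrow> complex vec"
  assume a: "\<forall>j<r. a j \<in> carrier_vec n"
  let ?T = "\<lambda>I. \<Sum>j<r. c j * outer_product n (replicate d (conjugate (a j)) @ replicate d (a j)) I"
  define vs where "vs j = replicate d (conjugate (a j)) @ replicate d (a j)" for j
  \<comment> \<open>Decompositions for \<open>tensor_rank\<close> carry no coefficients, so
    \<open>c j\<close> is absorbed into factor 0, which exists because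
    \<open>d \<ge> 1\<close>.\<close>
  define b where "b j k = (if k = 0 then c j \<cdot>\<^sub>v conjugate (a j) else vs j ! k)" for j k
  obtain e where d: "d = Suc e" using assms by (cases d) auto
  have b: "map (b j) [0..<2 * d] = c j \<cdot>\<^sub>v conjugate (a j) # tl (vs j)" for j
    by (rule nth_equalityI) (auto simp: b_def vs_def d nth_tl nth_Cons' nth_append)
  have vs: "vs j = conjugate (a j) # tl (vs j)" for j by (simp add: vs_def d)
  have "c j * outer_product n (vs j) I = outer_product n (map (b j) [0..<2 * d]) I"
    if "j < r" for j I
    using a that outer_product_smult_Cons[of "conjugate (a j)" n "c j" "tl (vs j)" I]
    by (simp add: b flip: vs)
  then have "?T = (\<lambda>I. \<Sum>j<r. outer_product n (map (b j) [0..<2 * d]) I)"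
    by (simp add: vs_def)
  moreover have "\<forall>j<r. \<forall>k<2 * d. b j k \<in> carrier_vec n"
    using a by (auto simp: b_def vs_def nth_append)
  ultimately show "tensor_rank n (2 * d) ?T \<le> enat r"
    unfolding tensor_rank_def by (intro Inf_lower) blast
qed

lemma ps_rank_le_cps_rank: "ps_rank n d T \<le> cps_rank n d T"
  unfolding cps_rank_def
proof (rule Inf_greatest, elim CollectE exE conjE)
  fix R r and c :: "nat \<Rightarrow> real" and a :: "nat \<Rightarrow> complex vec"
  assume R: "R = enat r" and a: "\<forall>j<r. a j \<in> carrier_vec n"
    and dec: "T = (\<lambda>I. \<Sum>j<r. complex_of_real (c j) *
          outer_product n (replicate d (conjugate (a j)) @ replicate d (a j)) I)"
  show "ps_rank n d T \<le> R"
    unfolding ps_rank_def R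
    by (rule Inf_lower, rule CollectI, rule exI[of _ r], rule conjI[OF refl],
        rule exI[of _ "\<lambda>j. complex_of_real (c j)"], rule exI[of _ a], rule conjI[OF a dec])
qed

text \<open>Averaging changes only the coefficients: the vectors and the number of terms are kept,
  so no rank is lost in passing from PS to CPS.\<close>

lemma cps_decomposition_Re:
  assumes T: "conj_partial_symmetric n d T" and a: "\<forall>j<r. a j \<in> carrier_vec n"
    and dec: "T = (\<lambda>I. \<Sum>j<r. c j *
                outer_product n (replicate d (conjugate (a j)) @ replicate d (a j)) I)"
  shows "T = (\<lambda>I. \<Sum>j<r. complex_of_real (Re (c j)) *
                outer_product n (replicate d (conjugate (a j)) @ replicate d (a j)) I)"
    (is "T = (\<lambda>K. \<Sum>j<r. _ * ?P j K)")
proof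
  fix K
  show "T K = (\<Sum>j<r. complex_of_real (Re (c j)) * ?P j K)"
  proof (cases "K \<in> indices n (d + d)")
    case True
    then obtain I J where K: "K = I @ J" and IJ: "I \<in> indices n d" "J \<in> indices n d"
      by (rule indices_split)
    have "T K = cnj (T (J @ I))"
      using T IJ unfolding K conj_partial_symmetric_def by blast
    also have "\<dots> = (\<Sum>j<r. cnj (c j) * ?P j K)"
      using a IJ by (auto simp: dec K cnj_outer_product_conjugate intro!: sum.cong)
    finally have "2 * T K = (\<Sum>j<r. c j * ?P j K) + (\<Sum>j<r. cnj (c j) * ?P j K)"
      by (simp add: fun_cong[OF dec, of K])
    also have "\<dots> = (\<Sum>j<r. (c j + cnj (c j)) * ?P j K)"
      by (simp add: sum.distrib distrib_right)
    also have "\<dots> = 2 * (\<Sum>j<r. complex_of_real (Re (c j)) * ?P j K)"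
      by (simp add: complex_add_cnj sum_distrib_left mult.assoc)
    finally show ?thesis by simp
  next
    case False
    then have "?P j K = 0" for j by (simp add: outer_product_def)
    then show ?thesis by (simp add: dec)
  qed
qed

lemma cps_rank_le_ps_rank:
  assumes "conj_partial_symmetric n d T"
  shows "cps_rank n d T \<le> ps_rank n d T"
  unfolding ps_rank_def
proof (rule Inf_greatest, elim CollectE exE conjE)
  fix R r c and a :: "nat \<Rightarrow> complex vec"
  assume R: "R = enat r" and a: "\<forall>j<r. a j \<in> carrier_vec n"
    and dec: "T = (\<lambda>I. \<Sum>j<r. c j *
          outer_product n (replicate d (conjugate (a j)) @ replicate d (a j)) I)"
  show "cps_rank n d T \<le> R"
    unfolding cps_rank_def R
    by (rule Inf_lower, rule CollectI, rule exI[of _ r], rule conjI[OF refl],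
        rule exI[of _ "\<lambda>j. Re (c j)"], rule exI[of _ a],
        rule conjI[OF a cps_decomposition_Re[OF assms a dec]])
qed

section \<open>A CPS tensor of rank at most two and PS rank at least three\<close>

definition swap_tensor :: "nat list \<Rightarrow> complex" where
  "swap_tensor I = (if I = [0,0,1,1] \<or> I = [1,1,0,0] then 1 else 0)"

lemma indices_2_cases:
  assumes "I \<in> indices 2 2"
  shows "I = [0,0] \<or> I = [0,1] \<or> I = [1,0] \<or> I = [1,1]"
proof -
  obtain i j where "I = [i, j]" "i < 2" "j < 2"
    using assms by (auto simp: indices_def length_Suc_conv numeral_2_eq_2)
  then show ?thesis by (simp add: less_2_cases_iff) blast
qed

lemma conj_partial_symmetric_swap_tensor: "conj_partial_symmetric 2 2 swap_tensor"
proof -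
  \<comment> \<open>This form depends only on the sets of entries of the two blocks and is symmetric
    in them, so invariance under permutations and under the swap can be read off.\<close>
  have append: "swap_tensor (I @ J) =
      (if set I = {0} \<and> set J = {1} \<or> set I = {1} \<and> set J = {0} then 1 else 0)"
    if "I \<in> indices 2 2" "J \<in> indices 2 2" for I J
    using indices_2_cases[OF that(1)] indices_2_cases[OF that(2)]
    by (elim disjE) (simp_all add: swap_tensor_def)
  have perm: "permute_list p I \<in> indices 2 2 \<and> set (permute_list p I) = set I"
    if "I \<in> indices 2 2" "p permutes {..<2}" for I p
    using that by (simp add: indices_def)
  have "swap_tensor \<in> tensors 2 (2 * 2)"
    by (auto simp: tensors_def swap_tensor_def indices_def)
  then show ?thesis
    unfolding conj_partial_symmetric_def partial_symmetric_def
    by (simp add: append perm)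
qed

lemma tensor_rank_swap_tensor: "tensor_rank 2 4 swap_tensor \<le> 2"
proof -
  \<comment> \<open>The term \<open>j = 0\<close> has the first unit vector in slots 0, 1 and the
    second in slots 2, 3; the term \<open>j = 1\<close> has them the other way round.\<close>
  define a :: "nat \<Rightarrow> nat \<Rightarrow> complex vec" where
    "a j k = (if (j = 0) = (k < 2) then unit_vec 2 0 else unit_vec 2 1)" for j k
  have "swap_tensor I = (\<Sum>j<2. outer_product 2 (map (a j) [0..<4]) I)" for I
  proof (cases "I \<in> indices 2 (2 + 2)")
    case True
    then obtain J K where I: "I = J @ K" "J \<in> indices 2 2" "K \<in> indices 2 2"
      by (rule indices_split)
    show ?thesis
      using True indices_2_cases[OF I(2)] indices_2_cases[OF I(3)]
      by (elim disjE) (simp_all add: I(1) swap_tensor_def outer_product_def a_def numeral_eq_Suc)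
  next
    case False
    then have "I \<noteq> [0,0,1,1]" "I \<noteq> [1,1,0,0]" by (auto simp: indices_def)
    with False show ?thesis by (simp add: swap_tensor_def outer_product_def)
  qed
  moreover have "\<forall>j<2. \<forall>k<4. a j k \<in> carrier_vec 2"
    by (simp add: a_def)
  ultimately have "tensor_rank 2 4 swap_tensor \<le> enat 2"
    unfolding tensor_rank_def by (intro Inf_lower) blast
  then show ?thesis by (simp add: numeral_eq_enat)
qed

text \<open>With nonzero weights, the first two equations force \<open>(x, y)\<close> and
  \<open>(x', y')\<close> to be proportional, so the third sum is a multiple of the first. The
  homogeneous form avoids the ratios \<open>y / x\<close>, which need not exist.\<close>

lemma no_two_point_moments:
  fixes c c' x x' y y' :: complex
  assumes "c * cnj x ^ 2 * x ^ 2 + c' * cnj x' ^ 2 * x' ^ 2 = 0"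
    and "c * cnj x ^ 2 * (x * y) + c' * cnj x' ^ 2 * (x' * y') = 0"
  shows "c * cnj x ^ 2 * y ^ 2 + c' * cnj x' ^ 2 * y' ^ 2 = 0"
proof -
  define u u' where "u = c * cnj x ^ 2" and "u' = c' * cnj x' ^ 2"
  note A = assms[folded u_def u'_def]
  show ?thesis
  proof (cases "u = 0 \<or> u' = 0")
    case True
    \<comment> \<open>If one weight vanishes, the first equation kills the other weight or its
      point's first coordinate, and that coordinate is a factor of the weight up to
      conjugation.\<close>
    then have "u = 0 \<and> u' = 0"
      using A(1) by (auto simp: u_def u'_def)
    then show ?thesis by (simp flip: u_def u'_def)
  next
    case False
    then have nz: "u \<noteq> 0" "x \<noteq> 0" "x' \<noteq> 0" by (auto simp: u_def u'_def)
    \<comment> \<open>Eliminates \<open>u'\<close> between the two equations.\<close>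
    have "u * x * (x' * y - x * y') =
        x' * (u * (x * y) + u' * (x' * y')) - y' * (u * x ^ 2 + u' * x' ^ 2)"
      by (simp add: algebra_simps power2_eq_square)
    then have eq: "x' * y = x * y'" using A nz by simp
    have "x ^ 2 * x' ^ 2 * (u * y ^ 2 + u' * y' ^ 2) =
        u * x ^ 2 * (x' * y) ^ 2 + u' * x' ^ 2 * (x * y') ^ 2"
      by (simp add: algebra_simps)
    also have "\<dots> = (u * x ^ 2 + u' * x' ^ 2) * (x * y') ^ 2"
      by (simp add: eq distrib_right)
    finally have "x ^ 2 * x' ^ 2 * (u * y ^ 2 + u' * y' ^ 2) = 0"
      using A(1) by simp
    then show ?thesis using nz by (simp flip: u_def u'_def)
  qed
qed

lemma ps_rank_swap_tensor: "2 < ps_rank 2 2 swap_tensor"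
proof -
  have "3 \<le> r"
    if dec: "swap_tensor = (\<lambda>I. \<Sum>j<r. c j *
          outer_product 2 (replicate 2 (conjugate (a j)) @ replicate 2 (a j)) I)"
      and a: "\<forall>j<r. a j \<in> carrier_vec 2"
    for r c and a :: "nat \<Rightarrow> complex vec"
  proof (rule ccontr)
    assume "\<not> 3 \<le> r"
    then have r: "r \<le> 2" by simp
    \<comment> \<open>Padding with zero coefficients treats all \<open>r \<le> 2\<close> as sums of
      exactly two terms.\<close>
    define c' where "c' j = (if j < r then c j else 0)" for j
    \<comment> \<open>Fixing the first two indices at 0 turns the conjugated factors into a weight
      independent of \<open>k\<close> and \<open>l\<close>.\<close>
    have entry: "swap_tensor [0,0,k,l] =
        c' 0 * cnj (a 0 $ 0) ^ 2 * (a 0 $ k * a 0 $ l) +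
        c' 1 * cnj (a 1 $ 0) ^ 2 * (a 1 $ k * a 1 $ l)" if "k < 2" "l < 2" for k l
    proof -
      have "swap_tensor [0,0,k,l] =
          (\<Sum>j<r. c' j * cnj (a j $ 0) ^ 2 * (a j $ k * a j $ l))"
        using that a by (auto simp: dec outer_product_def indices_def c'_def numeral_eq_Suc
            mult.assoc intro!: sum.cong)
      also have "\<dots> = (\<Sum>j<2. c' j * cnj (a j $ 0) ^ 2 * (a j $ k * a j $ l))"
        using r by (intro sum.mono_neutral_left) (auto simp: c'_def)
      finally show ?thesis by (simp add: numeral_2_eq_2)
    qed
    show False
      \<comment> \<open>The first two entries are 0, so the third would have to be 0, but it is
        1.\<close>
      using entry[of 0 0] entry[of 0 1] entry[of 1 1]
        no_two_point_moments[of "c' 0" "a 0 $ 0" "c' 1" "a 1 $ 0" "a 0 $ 1" "a 1 $ 1"]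
      by (simp add: swap_tensor_def power2_eq_square)
  qed
  then have "enat 3 \<le> ps_rank 2 2 swap_tensor"
    unfolding ps_rank_def by (intro Inf_greatest) auto
  then show ?thesis
    by (rule less_le_trans[rotated]) (simp add: numeral_eq_enat)
qed

theorem theorem3p5:
  shows "(\<forall>n d :: nat. \<forall>T :: nat list \<Rightarrow> complex.
            n \<ge> 1 \<longrightarrow> d \<ge> 1 \<longrightarrow> conj_partial_symmetric n d T \<longrightarrow>
            tensor_rank n (2 * d) T \<le> ps_rank n d T \<and> ps_rank n d T = cps_rank n d T) \<and>
         (\<exists>(n :: nat) (d :: nat) (T :: nat list \<Rightarrow> complex).
            n \<ge> 1 \<and> d \<ge> 1 \<and> conj_partial_symmetric n d T \<and>
            tensor_rank n (2 * d) T < ps_rank n d T)"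
proof (intro conjI allI impI)
  fix n d T
  assume "d \<ge> 1" "conj_partial_symmetric n d T"
  then show "tensor_rank n (2 * d) T \<le> ps_rank n d T" "ps_rank n d T = cps_rank n d T"
    by (auto intro: tensor_rank_le_ps_rank antisym ps_rank_le_cps_rank cps_rank_le_ps_rank)
next
  have "tensor_rank 2 (2 * 2) swap_tensor < ps_rank 2 2 swap_tensor"
    using tensor_rank_swap_tensor ps_rank_swap_tensor by (simp add: le_less_trans)
  then show "\<exists>n d T. n \<ge> 1 \<and> d \<ge> 1 \<and> conj_partial_symmetric n d T \<and>
      tensor_rank n (2 * d) T < ps_rank n d T"
    using conj_partial_symmetric_swap_tensor
    by (intro exI[of _ 2] exI[of _ swap_tensor]) simp
qed

end
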